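(* Let $\mathcal X:=\{0,1\}^{\mathbb N}$ with its product $\sigma$-algebra $\mathcal B(\mathcal X)$, let $(X_t)_{t\ge1}$ be the coordinate process, let $\bar X_n:=\frac1n\sum_{t=1}^nX_t$, let $D:=\{\lim_{n\to\infty}\bar X_n\text{ exists}\}$, and define $L:\mathcal X\to[0,1]$ by $L(\omega):=\lim_{n\to\infty}\bar X_n(\omega)$ if $\omega\in D$ and $L(\omega):=0$ if $\omega\notin D$. (1) If $\mathbb P$ is an exchangeable probability law on $(\mathcal X,\mathcal B(\mathcal X))$, then there exists a $[0,1]$-valued random variable $\Theta$ such that $\bar X_n\to\Theta$ $\mathbb P$-almost surely, and the law of $\Theta$ is the de Finetti mixing measure $\mu$ of $\mathbb P$ on $[0,1]$. In particular, for each $p\in[0,1]$, $\mathbb P(L=p)=\mu(\{p\})$. (2) Fix any $p\in(0,1)$ and any $\alpha\in(0,1)$. There exist distinct exchangeable probability laws $\mathbb P_1\neq\mathbb P_2$ on $(\mathcal X,\mathcal B(\mathcal X))$ such that $\mathbb P_1(L=p)=\mathbb P_2(L=p)=\alpha$.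
   Context: A probability law on $\mathcal X$ is exchangeable if under it, for every $n\ge1$ and every permutation $\pi$ of $\{1,\ldots,n\}$, $(X_1,\ldots,X_n)$ and $(X_{\pi(1)},\ldots,X_{\pi(n)})$ have the same distribution. The de Finetti mixing measure of an exchangeable law $\mathbb P$ is the unique Borel probability measure $\mu$ on $[0,1]$ such that for all $n\ge1$ and $(x_1,\ldots,x_n)\in\{0,1\}^n$, $\mathbb P(X_1=x_1,\ldots,X_n=x_n)=\int_0^1\prod_{t=1}^n\theta^{x_t}(1-\theta)^{1-x_t}\,\mu(d\theta)$. *)

theory Defs
  imports "HOL-Probability.Probability"
begin

text \<open>
  A binary sequence \<open>(\<omega>\<^sub>t)\<^sub>t\<^sub>\<ge>\<^sub>1\<close> is a function on the index set \<open>{1..}\<close> with values in \<open>{0, 1}\<close>,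
  extended by \<^term>\<open>undefined\<close> at index \<open>0\<close>, as is the convention for \<^const>\<open>PiM\<close>.
  The coordinate process is \<open>X\<^sub>t \<omega> = \<omega> t\<close>.
\<close>

definition seq_space :: "(nat \<Rightarrow> nat) measure" where
  "seq_space = PiM {1..} (\<lambda>_. count_space {0, 1})"

definition word_space :: "nat \<Rightarrow> (nat \<Rightarrow> nat) measure" where
  "word_space n = PiM {1..n} (\<lambda>_. count_space {0, 1})"

definition unit_borel :: "real measure" where
  "unit_borel = restrict_space borel {0..1}"

definition probability_law :: "(nat \<Rightarrow> nat) measure \<Rightarrow> bool" where
  "probability_law P \<longleftrightarrow> prob_space P \<and> sets P = sets seq_space"

definition exchangeable :: "(nat \<Rightarrow> nat) measure \<Rightarrow> bool" where
  "exchangeable P \<longleftrightarrow>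
     (\<forall>n\<ge>1. \<forall>\<pi>. \<pi> permutes {1..n} \<longrightarrow>
        distr P (word_space n) (\<lambda>\<omega>. \<lambda>t\<in>{1..n}. \<omega> t) =
        distr P (word_space n) (\<lambda>\<omega>. \<lambda>t\<in>{1..n}. \<omega> (\<pi> t)))"

definition represents :: "real measure \<Rightarrow> (nat \<Rightarrow> nat) measure \<Rightarrow> bool" where
  "represents \<mu> P \<longleftrightarrow>
     prob_space \<mu> \<and> sets \<mu> = sets unit_borel \<and>
     (\<forall>n\<ge>1. \<forall>x \<in> {1..n} \<rightarrow>\<^sub>E {0, 1}.
        measure P {\<omega> \<in> space P. \<forall>t\<in>{1..n}. \<omega> t = x t} =
        (LINT \<theta>|\<mu>. (\<Prod>t=1..n. \<theta> ^ x t * (1 - \<theta>) ^ (1 - x t))))"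

text \<open>
  \<open>\<mu>\<close> is \<^emph>\<open>the\<close> mixing measure of \<open>P\<close>; uniqueness is part of the notion. The predicate is
  used instead of a definite description so that existence is never taken for granted.
\<close>

definition de_finetti_mixing_measure :: "(nat \<Rightarrow> nat) measure \<Rightarrow> real measure \<Rightarrow> bool" where
  "de_finetti_mixing_measure P \<mu> \<longleftrightarrow>
     represents \<mu> P \<and> (\<forall>\<nu>. represents \<nu> P \<longrightarrow> \<nu> = \<mu>)"

text \<open>The junk value at \<open>n = 0\<close> is irrelevant, as only limits for \<open>n \<rightarrow> \<infinity>\<close> are used.\<close>

definition sample_mean :: "nat \<Rightarrow> (nat \<Rightarrow> nat) \<Rightarrow> real" where
  "sample_mean n \<omega> = (\<Sum>t=1..n. real (\<omega> t)) / real n"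

definition mean_converges :: "(nat \<Rightarrow> nat) set" where
  "mean_converges = {\<omega> \<in> space seq_space. convergent (\<lambda>n. sample_mean n \<omega>)}"

definition limit_frequency :: "(nat \<Rightarrow> nat) \<Rightarrow> real" where
  "limit_frequency \<omega> =
     (if \<omega> \<in> mean_converges then lim (\<lambda>n. sample_mean n \<omega>) else 0)"

lemma measurable_coordinate:
  "t \<ge> 1 \<Longrightarrow> (\<lambda>\<omega>. real (\<omega> t)) \<in> borel_measurable seq_space"
  unfolding seq_space_def
  by (rule measurable_compose[OF measurable_component_singleton]) auto

lemma measurable_sample_mean [measurable]:
  "sample_mean n \<in> borel_measurable seq_space"
  unfolding sample_mean_def
  by (intro borel_measurable_divide borel_measurable_sum measurable_coordinate) auto

lemma sample_mean_unit_interval: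
  assumes "\<omega> \<in> space seq_space"
  shows "sample_mean n \<omega> \<in> {0..1}"
proof -
  have "real (\<omega> t) \<le> 1" if "t \<in> {1..n}" for t
    using assms that by (force simp: seq_space_def space_PiM PiE_iff)
  then have "(\<Sum>t=1..n. real (\<omega> t)) \<le> (\<Sum>t=1..n. 1)"
    by (rule sum_mono)
  then show ?thesis
    by (cases "n = 0") (auto simp: sample_mean_def sum_nonneg)
qed

lemma limit_frequency_unit_interval:
  assumes "\<omega> \<in> space seq_space"
  shows "limit_frequency \<omega> \<in> {0..1}"
proof (cases "\<omega> \<in> mean_converges")
  case True
  then have "(\<lambda>n. sample_mean n \<omega>) \<longlonglongrightarrow> limit_frequency \<omega>"
    by (simp add: limit_frequency_def mean_converges_def convergent_LIMSEQ_iff)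
  then show ?thesis
    using sample_mean_unit_interval[OF assms]
    by (rule closed_sequentially[of "{0..1}" "\<lambda>n. sample_mean n \<omega>", OF closed_atLeastAtMost, rotated])
qed (simp add: limit_frequency_def)

lemma measurable_limit_frequency:
  "limit_frequency \<in> seq_space \<rightarrow>\<^sub>M unit_borel"
proof -
  have conv: "mean_converges \<in> sets seq_space"
    unfolding mean_converges_def Cauchy_convergent_iff[symmetric]
    by (rule sets_Collect_Cauchy) (rule measurable_sample_mean)
  have "limit_frequency \<in> borel_measurable seq_space"
    unfolding limit_frequency_def
    using conv by (intro measurable_If_set borel_measurable_lim_metric) (simp_all add: measurable_sample_mean)
  then show ?thesis
    unfolding unit_borel_def
    by (intro measurable_restrict_space2) (use limit_frequency_unit_interval in auto)
qed

end

theory Submission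
  imports Defs "HOL-Real_Asymp.Real_Asymp"
begin

text \<open>
  For an exchangeable law, put \<open>M\<^sub>n\<close> for the sample mean. Expanding a square and using that all
  pairs of distinct coordinates have the same joint law gives \<open>E (M\<^sub>n - M\<^sub>m)\<^sup>2 \<le> 1 / m\<close> for
  \<open>1 \<le> m \<le> n\<close>. Along the fourth powers this makes the increments summable in \<open>L\<^sup>1\<close>, so the means converge
  almost surely along them; the gaps between consecutive fourth powers are relatively small, so the
  means converge along all indices (\<open>AE_sample_mean_converges\<close>). The random variable asked for is
  the limiting frequency \<open>L\<close> itself.

  To identify its law, write the indicator of a cylinder \<open>X\<^sub>1 = x\<^sub>1, \<dots>, X\<^sub>n = x\<^sub>n\<close> as a product of
  factors \<open>w (x\<^sub>t) (X\<^sub>t)\<close> with \<open>w b \<theta> = \<theta>\<^sup>b (1 - \<theta>)\<^sup>1\<^sup>-\<^sup>b\<close>. Exchangeability under a transposition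
  replaces one factor by the average of the same factor over many later coordinates, which converges
  to \<open>w (x\<^sub>t) L\<close> because \<open>w b\<close> is affine; doing this for one coordinate after the other
  (\<open>expectation_replace_weight\<close>) shows that the law of \<open>L\<close> represents the exchangeable law. It is
  the only representing measure, since moments determine a law on the unit interval
  (\<open>unit_borel_eqI_moments\<close>). The atoms of \<open>L\<close> are then those of the mixing measure.

  For the second claim, choose a coin at random, with parameter \<open>p\<close> with probability \<open>\<alpha>\<close> and
  parameter \<open>q\<close> otherwise. The resulting sequence is exchangeable with a two-point mixing measure, so
  the limiting frequency is \<open>p\<close> with probability \<open>\<alpha>\<close>, and the choices \<open>q = 0\<close> and \<open>q = 1\<close> give
  different laws.
\<close>

section \<open>Binary sequences and their averages\<close>

lemma binary_coordinate:
  assumes "\<omega> \<in> space seq_space" "t \<ge> 1"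
  shows "\<omega> t = 0 \<or> \<omega> t = 1"
proof -
  have "\<omega> t \<in> {0, 1}"
    using assms by (auto simp: seq_space_def space_PiM PiE_iff)
  then show ?thesis by simp
qed

lemma sets_cylinder:
  assumes "x \<in> {1..n} \<rightarrow>\<^sub>E {0, 1}" "n \<ge> 1"
  shows "{\<omega> \<in> space seq_space. \<forall>t\<in>{1..n}. \<omega> t = x t} \<in> sets seq_space"
proof (rule sets.sets_Collect_finite_All'[OF _ finite_atLeastAtMost])
  show "{\<omega> \<in> space seq_space. \<omega> t = x t} \<in> sets seq_space" if "t \<in> {1..n}" for t
    using that assms(1) unfolding seq_space_def
    by (intro sets_Collect_single'[where P="\<lambda>c. c = x t"]) (auto simp: PiE_iff)
qed (use assms(2) in auto)

lemma measurable_limit_frequency_law: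
  assumes "sets P = sets seq_space"
  shows "limit_frequency \<in> P \<rightarrow>\<^sub>M unit_borel"
  using measurable_limit_frequency unfolding measurable_cong_sets[OF assms refl] .

lemma sample_mean_diff_le:
  assumes \<omega>: "\<omega> \<in> space seq_space" and mn: "m \<le> n" "m \<ge> 1"
  shows "\<bar>sample_mean n \<omega> - sample_mean m \<omega>\<bar> \<le> (real n - real m) / real n"
proof -
  define S where "S k = (\<Sum>t=1..k. real (\<omega> t))" for k
  have split: "S n = S m + (\<Sum>t\<in>{m<..n}. real (\<omega> t))"
  proof -
    have "{1..n} = {1..m} \<union> {m<..n}" using mn by auto
    then show ?thesis unfolding S_def by (simp only:) (rule sum.union_disjoint; auto)
  qed
  have le1: "real (\<omega> t) \<le> 1" if "t \<ge> 1" for t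
    using binary_coordinate[OF \<omega> that] by auto
  have "(\<Sum>t\<in>{m<..n}. real (\<omega> t)) \<le> (\<Sum>t\<in>{m<..n}. 1)"
    using mn by (intro sum_mono le1) auto
  then have up: "S n \<le> S m + (real n - real m)"
    using mn by (simp add: split of_nat_diff)
  have lo: "S m \<le> S n" by (simp add: split sum_nonneg)
  have "S m \<le> (\<Sum>t=1..m. 1)" unfolding S_def by (intro sum_mono le1) auto
  then have Sm: "0 \<le> S m" "S m \<le> real m" by (simp_all add: S_def sum_nonneg)
  have pos: "real n > 0" "real m > 0" using mn by auto
  have eq: "S n / real n - S m / real m = (S n - S m) / real n - S m / real m * ((real n - real m) / real n)"
    using pos by (simp add: field_simps)
  have "0 \<le> (S n - S m) / real n" "(S n - S m) / real n \<le> (real n - real m) / real n"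
    using lo up pos by (auto intro!: divide_right_mono)
  moreover have "0 \<le> S m / real m * ((real n - real m) / real n)"
    using Sm mn by auto
  moreover have "S m / real m * ((real n - real m) / real n) \<le> 1 * ((real n - real m) / real n)"
    using Sm pos mn by (intro mult_right_mono) auto
  ultimately show ?thesis
    unfolding sample_mean_def S_def[symmetric] eq abs_le_iff by linarith
qed

text \<open>
  The fourth powers are dense enough to control the whole sequence: the fraction of \<open>{1..n}\<close>
  above the largest fourth power up to \<open>n\<close> tends to \<open>0\<close>, and by the preceding estimate it bounds
  the change of the mean.
\<close>

lemma convergent_sample_mean_of_powers:
  assumes \<omega>: "\<omega> \<in> space seq_space"
    and conv: "convergent (\<lambda>k. sample_mean (k ^ 4) \<omega>)"
  shows "convergent (\<lambda>n. sample_mean n \<omega>)"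
proof -
  define k where "k n = nat \<lfloor>real n powr (1/4)\<rfloor>" for n
  obtain l where "(\<lambda>k. sample_mean (k ^ 4) \<omega>) \<longlonglongrightarrow> l"
    using conv by (auto simp: convergent_def)
  moreover have "filterlim k at_top sequentially"
    unfolding k_def by real_asymp
  ultimately have sub: "(\<lambda>n. sample_mean (k n ^ 4) \<omega>) \<longlonglongrightarrow> l"
    by (rule filterlim_compose)
  have gap: "(\<lambda>n. (real n - real (k n) ^ 4) / real n) \<longlonglongrightarrow> 0"
    unfolding k_def by real_asymp
  have "\<bar>sample_mean n \<omega> - sample_mean (k n ^ 4) \<omega>\<bar> \<le> (real n - real (k n) ^ 4) / real n"
    if n: "n \<ge> 1" for n
  proof -
    have "real n powr (1/4) \<ge> 1"
      using n by (intro ge_one_powr_ge_zero) auto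
    then have "1 \<le> k n" unfolding k_def by linarith
    moreover have "real (k n) ^ 4 \<le> (real n powr (1/4)) ^ 4"
      unfolding k_def by (intro power_mono) auto
    then have "real (k n ^ 4) \<le> real n"
      using n by (simp add: powr_power)
    then have "k n ^ 4 \<le> n" by (simp only: of_nat_le_iff)
    ultimately show ?thesis
      using sample_mean_diff_le[OF \<omega>, of "k n ^ 4" n] by simp
  qed
  then have "(\<lambda>n. sample_mean n \<omega> - sample_mean (k n ^ 4) \<omega>) \<longlonglongrightarrow> 0"
    by (intro Lim_null_comparison[OF _ gap]) (auto simp: eventually_at_top_linorder)
  from tendsto_add[OF this sub] show ?thesis
    by (auto simp: convergent_def)
qed

section \<open>Exchangeable laws\<close>

text \<open>
  Since word spaces are finite and discrete, every function on words is measurable.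
\<close>

lemma word_space_eq: "word_space n = count_space ({1..n} \<rightarrow>\<^sub>E {0, 1})"
  unfolding word_space_def by (rule count_space_PiM_finite) auto

text \<open>
  An exchangeable law of a binary sequence, as a locale on top of \<^locale>\<open>prob_space\<close>.
\<close>

locale exchangeable_law = prob_space P for P :: "(nat \<Rightarrow> nat) measure" +
  assumes sets_P [measurable_cong]: "sets P = sets seq_space"
    and exch: "exchangeable P"
begin

lemma space_P: "space P = space seq_space"
  using sets_P by (rule sets_eq_imp_space_eq)

lemma measurable_coord [measurable]:
  "t \<ge> 1 \<Longrightarrow> (\<lambda>\<omega>. \<omega> t) \<in> P \<rightarrow>\<^sub>M count_space {0, 1}"
  unfolding measurable_cong_sets[OF sets_P refl] unfolding seq_space_def by simp

lemma measurable_coord_comp: "t \<ge> 1 \<Longrightarrow> (\<lambda>\<omega>. f (\<omega> t)) \<in> borel_measurable P"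
  by (rule measurable_compose[OF measurable_coord]) auto

lemma measurable_word:
  assumes "\<And>t. t \<in> {1..n} \<Longrightarrow> \<pi> t \<ge> 1"
  shows "(\<lambda>\<omega>. \<lambda>t\<in>{1..n}. \<omega> (\<pi> t)) \<in> P \<rightarrow>\<^sub>M word_space n"
  unfolding word_space_def using assms by (intro measurable_restrict measurable_coord) auto

text \<open>
  Exchangeability in integrated form. The hypothesis \<open>dep\<close> says that \<open>f\<close> depends on the first
  \<open>n\<close> coordinates only.
\<close>

lemma integral_permute:
  fixes f :: "(nat \<Rightarrow> nat) \<Rightarrow> real"
  assumes n: "n \<ge> 1" and \<pi>: "\<pi> permutes {1..n}"
    and dep: "\<And>\<omega>. f (restrict \<omega> {1..n}) = f \<omega>"
  shows "(LINT \<omega>|P. f (\<lambda>t. \<omega> (\<pi> t))) = (LINT \<omega>|P. f \<omega>)"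
proof -
  have \<pi>1: "\<pi> t \<ge> 1" if "t \<in> {1..n}" for t
    using permutes_in_image[OF \<pi>, of t] that by auto
  have f: "f \<in> borel_measurable (word_space n)"
    by (simp add: word_space_eq)
  have "(LINT \<omega>|P. f (\<lambda>t. \<omega> (\<pi> t))) = (LINT \<omega>|P. f (\<lambda>t\<in>{1..n}. \<omega> (\<pi> t)))"
    by (simp only: dep)
  also have "\<dots> = integral\<^sup>L (distr P (word_space n) (\<lambda>\<omega>. \<lambda>t\<in>{1..n}. \<omega> (\<pi> t))) f"
    using measurable_word[OF \<pi>1] f by (simp add: integral_distr)
  also have "\<dots> = integral\<^sup>L (distr P (word_space n) (\<lambda>\<omega>. \<lambda>t\<in>{1..n}. \<omega> t)) f"
    using exch n \<pi> by (simp add: exchangeable_def)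
  also have "\<dots> = (LINT \<omega>|P. f (\<lambda>t\<in>{1..n}. \<omega> t))"
    using measurable_word[of n "\<lambda>t. t"] f by (simp add: integral_distr)
  also have "\<dots> = (LINT \<omega>|P. f \<omega>)"
    by (simp only: dep)
  finally show ?thesis .
qed

lemma integrable_bounded:
  fixes f :: "(nat \<Rightarrow> nat) \<Rightarrow> real"
  assumes "f \<in> borel_measurable P" "\<And>\<omega>. \<omega> \<in> space seq_space \<Longrightarrow> \<bar>f \<omega>\<bar> \<le> B"
  shows "integrable P f"
  using assms by (intro integrable_const_bound[where B=B]) (auto simp: space_P)

lemma integrable_coord_mult:
  assumes "i \<ge> 1" "j \<ge> 1"
  shows "integrable P (\<lambda>\<omega>. real (\<omega> i) * real (\<omega> j))"
proof (rule integrable_bounded[where B=1])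
  show "(\<lambda>\<omega>. real (\<omega> i) * real (\<omega> j)) \<in> borel_measurable P"
    using assms by (intro borel_measurable_times measurable_coord_comp)
  show "\<bar>real (\<omega> i) * real (\<omega> j)\<bar> \<le> 1" if "\<omega> \<in> space seq_space" for \<omega>
    using binary_coordinate[OF that assms(1)] binary_coordinate[OF that assms(2)] by auto
qed

text \<open>
  All pairs of distinct coordinates have the same joint law, because some permutation of a finite
  initial segment maps \<open>1\<close> to \<open>i\<close> and \<open>2\<close> to \<open>j\<close>.
\<close>

lemma second_moment:
  assumes "i \<ge> 1" "j \<ge> 1" "i \<noteq> j"
  shows "(LINT \<omega>|P. real (\<omega> i) * real (\<omega> j)) = (LINT \<omega>|P. real (\<omega> 1) * real (\<omega> 2))"
proof -
  define \<pi> where "\<pi> = Transposition.transpose 1 i \<circ> Transposition.transpose 2 (Transposition.transpose 1 i j)"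
  define n where "n = i + j"
  have "Transposition.transpose 1 i j \<in> {1..n}"
    using assms by (auto simp: n_def Transposition.transpose_def)
  then have \<pi>: "\<pi> permutes {1..n}"
    unfolding \<pi>_def using assms by (intro permutes_compose permutes_swap_id) (auto simp: n_def)
  have *: "\<pi> 1 = i" "\<pi> 2 = j"
    using assms by (auto simp: \<pi>_def Transposition.transpose_def)
  have "n \<ge> 1" "n \<ge> 2" using assms by (auto simp: n_def)
  then show ?thesis
    using integral_permute[OF _ \<pi>, of "\<lambda>\<omega>. real (\<omega> 1) * real (\<omega> 2)"]
    unfolding * by simp
qed

lemma second_moment_same:
  assumes "i \<ge> 1"
  shows "(LINT \<omega>|P. real (\<omega> i) * real (\<omega> i)) = (LINT \<omega>|P. real (\<omega> 1) * real (\<omega> 1))"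
  using integral_permute[of i "Transposition.transpose 1 i" "\<lambda>\<omega>. real (\<omega> 1) * real (\<omega> 1)"] assms
  by (simp add: permutes_swap_id)

text \<open>
  With \<open>v = E X\<^sub>1\<^sup>2\<close> and \<open>c = E X\<^sub>1 X\<^sub>2\<close>, the second moment of \<open>\<Sum> a\<^sub>i X\<^sub>i\<close> is
  \<open>c (\<Sum> a\<^sub>i)\<^sup>2 + (v - c) \<Sum> a\<^sub>i\<^sup>2\<close>; the first term vanishes and \<open>v - c \<le> 1\<close>.
\<close>

lemma centred_combination_le:
  assumes "(\<Sum>i=1..n. a i) = 0"
  shows "(LINT \<omega>|P. (\<Sum>i=1..n. a i * real (\<omega> i))\<^sup>2) \<le> (\<Sum>i=1..n. (a i)\<^sup>2)"
proof -
  define v where "v = (LINT \<omega>|P. real (\<omega> 1) * real (\<omega> 1))"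
  define c where "c = (LINT \<omega>|P. real (\<omega> 1) * real (\<omega> 2))"
  have mom: "(LINT \<omega>|P. real (\<omega> i) * real (\<omega> j)) = c + (if i = j then v - c else 0)"
    if "i \<in> {1..n}" "j \<in> {1..n}" for i j
    using second_moment[of i j] second_moment_same[of i] that by (auto simp: c_def v_def)
  have "(LINT \<omega>|P. (\<Sum>i=1..n. a i * real (\<omega> i))\<^sup>2)
      = (LINT \<omega>|P. (\<Sum>i=1..n. \<Sum>j=1..n. a i * a j * (real (\<omega> i) * real (\<omega> j))))"
    by (simp add: power2_eq_square sum_product mult_ac)
  also have "\<dots> = (\<Sum>i=1..n. \<Sum>j=1..n. a i * a j * (LINT \<omega>|P. real (\<omega> i) * real (\<omega> j)))"
    by (subst Bochner_Integration.integral_sum Bochner_Integration.integrable_sum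
          | auto simp: integrable_coord_mult intro!: sum.cong)+
  also have "\<dots> = (\<Sum>i=1..n. \<Sum>j=1..n. a i * a j * c + (if i = j then a i * a j * (v - c) else 0))"
    by (intro sum.cong refl) (subst mom, auto simp: algebra_simps)
  also have "\<dots> = c * (\<Sum>i=1..n. a i) * (\<Sum>j=1..n. a j) + (v - c) * (\<Sum>i=1..n. (a i)\<^sup>2)"
    by (simp add: sum.distrib sum_product sum_distrib_left sum_distrib_right power2_eq_square mult_ac)
  also have "\<dots> = (v - c) * (\<Sum>i=1..n. (a i)\<^sup>2)"
    using assms by simp
  also have "\<dots> \<le> 1 * (\<Sum>i=1..n. (a i)\<^sup>2)"
  proof (rule mult_right_mono)
    have "v \<le> (LINT \<omega>|P. 1)"
      unfolding v_def
    proof (rule integral_mono[OF integrable_coord_mult])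
      show "real (\<omega> 1) * real (\<omega> 1) \<le> 1" if "\<omega> \<in> space P" for \<omega>
        using binary_coordinate[of \<omega> 1] that by (auto simp: space_P)
    qed auto
    moreover have "c \<ge> 0" unfolding c_def by simp
    ultimately show "v - c \<le> 1" by (simp add: prob_space)
  qed (simp add: sum_nonneg)
  finally show ?thesis by simp
qed

lemma sample_mean_L2:
  assumes "1 \<le> m" "m \<le> n"
  shows "(LINT \<omega>|P. (sample_mean n \<omega> - sample_mean m \<omega>)\<^sup>2) \<le> 1 / real m"
proof -
  \<comment> \<open>the coefficients that express the difference of the two means in the coordinates\<close>
  define a where "a i = 1 / real n - (if i \<le> m then 1 / real m else 0)" for i
  have set: "{1..n} \<inter> {i. i \<le> m} = {1..m}" using assms by auto
  have ind: "(\<Sum>i=1..n. if i \<le> m then f i else 0) = (\<Sum>i=1..m. f i)" for f :: "nat \<Rightarrow> real"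
    unfolding set[symmetric] by (simp add: sum.inter_restrict)
  have pos: "real n > 0" "real m > 0" using assms by auto
  have lin: "sample_mean n \<omega> - sample_mean m \<omega> = (\<Sum>i=1..n. a i * real (\<omega> i))" for \<omega>
  proof -
    have "(\<Sum>i=1..n. a i * real (\<omega> i))
        = (\<Sum>i=1..n. real (\<omega> i) / real n - (if i \<le> m then real (\<omega> i) / real m else 0))"
      by (intro sum.cong refl) (auto simp: a_def algebra_simps)
    also have "\<dots> = sample_mean n \<omega> - sample_mean m \<omega>"
      unfolding sum_subtractf ind by (simp add: sample_mean_def sum_divide_distrib)
    finally show ?thesis by simp
  qed
  have "(\<Sum>i=1..n. a i) = 0"
    unfolding a_def sum_subtractf ind using pos by simp
  then have "(LINT \<omega>|P. (sample_mean n \<omega> - sample_mean m \<omega>)\<^sup>2) \<le> (\<Sum>i=1..n. (a i)\<^sup>2)"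
    unfolding lin by (rule centred_combination_le)
  also have "\<dots> = (\<Sum>i=1..n. 1 / (real n)\<^sup>2
      - (if i \<le> m then 2 / (real m * real n) - 1 / (real m)\<^sup>2 else 0))"
    using pos by (intro sum.cong refl) (auto simp: a_def power2_eq_square field_simps)
  also have "\<dots> = 1 / real m - 1 / real n"
    unfolding sum_subtractf ind using pos by (simp add: power2_eq_square field_simps)
  also have "\<dots> \<le> 1 / real m" by simp
  finally show ?thesis .
qed

text \<open>
  Along the fourth powers the increments of the mean have squared \<open>L\<^sup>2\<close> norm at most \<open>1 / k ^ 4\<close>,
  hence a summable \<open>L\<^sup>1\<close> norm.
\<close>

lemma sample_mean_powers_L1:
  assumes "k \<ge> 1"
  shows "(LINT \<omega>|P. \<bar>sample_mean (Suc k ^ 4) \<omega> - sample_mean (k ^ 4) \<omega>\<bar>) \<le> 1 / real k ^ 2"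
proof -
  define d where "d \<omega> = sample_mean (Suc k ^ 4) \<omega> - sample_mean (k ^ 4) \<omega>" for \<omega>
  have [measurable]: "d \<in> borel_measurable P" unfolding d_def by measurable
  have d1: "\<bar>d \<omega>\<bar> \<le> 1" if "\<omega> \<in> space seq_space" for \<omega>
    using sample_mean_unit_interval[OF that, of "Suc k ^ 4"]
      sample_mean_unit_interval[OF that, of "k ^ 4"] by (auto simp: d_def)
  have int: "integrable P (\<lambda>\<omega>. \<bar>d \<omega>\<bar>)" by (rule integrable_bounded[where B=1]) (use d1 in auto)
  have int2: "integrable P (\<lambda>\<omega>. (d \<omega>)\<^sup>2)"
    by (rule integrable_bounded[where B=1]) (use d1 in \<open>auto simp: abs_square_le_1\<close>)
  have k: "real k > 0" using assms by simp
  have "k ^ 4 \<ge> 1" "k ^ 4 \<le> Suc k ^ 4" using assms by (auto intro!: power_mono)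
  then have L2: "(LINT \<omega>|P. (d \<omega>)\<^sup>2) \<le> 1 / real k ^ 4"
    using sample_mean_L2[of "k ^ 4" "Suc k ^ 4"] by (simp add: d_def)
  \<comment> \<open>arithmetic-geometric mean inequality, weighted so that both terms have expectation of order \<open>1 / k ^ 2\<close>\<close>
  have amgm: "\<bar>y\<bar> \<le> (real k ^ 2 * y\<^sup>2 + 1 / real k ^ 2) / 2" for y :: real
  proof -
    have "0 \<le> (real k * \<bar>y\<bar> - 1 / real k)\<^sup>2" by simp
    also have "\<dots> = real k ^ 2 * y\<^sup>2 + 1 / real k ^ 2 - 2 * \<bar>y\<bar>"
      using k by (simp add: power2_diff power_mult_distrib power_divide)
    finally show ?thesis by simp
  qed
  have "(LINT \<omega>|P. \<bar>d \<omega>\<bar>) \<le> (LINT \<omega>|P. (real k ^ 2 * (d \<omega>)\<^sup>2 + 1 / real k ^ 2) / 2)"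
    by (intro integral_mono int amgm) (use int2 in auto)
  also have "\<dots> = (real k ^ 2 * (LINT \<omega>|P. (d \<omega>)\<^sup>2) + 1 / real k ^ 2) / 2"
    using int2 by (simp add: prob_space)
  also have "\<dots> \<le> (real k ^ 2 * (1 / real k ^ 4) + 1 / real k ^ 2) / 2"
    using L2 k by (intro divide_right_mono add_right_mono mult_left_mono) auto
  also have "\<dots> = 1 / real k ^ 2"
    using k by (simp add: field_simps eval_nat_numeral)
  finally show ?thesis unfolding d_def .
qed

text \<open>
  The strong law for exchangeable sequences: the increments of the mean along the fourth powers are
  almost surely absolutely summable, so the mean converges along them and then along all indices.
\<close>

lemma AE_sample_mean_converges:
  "AE \<omega> in P. (\<lambda>n. sample_mean n \<omega>) \<longlonglongrightarrow> limit_frequency \<omega>"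
proof -
  define d where "d k \<omega> = \<bar>sample_mean (Suc (Suc k) ^ 4) \<omega> - sample_mean (Suc k ^ 4) \<omega>\<bar>" for k \<omega>
  have [measurable]: "d k \<in> borel_measurable P" for k unfolding d_def by measurable
  have nonneg: "d k \<omega> \<ge> 0" for k \<omega> by (simp add: d_def)
  have d1: "\<bar>d k \<omega>\<bar> \<le> 1" if "\<omega> \<in> space seq_space" for \<omega> k
    using sample_mean_unit_interval[OF that, of "Suc (Suc k) ^ 4"]
      sample_mean_unit_interval[OF that, of "Suc k ^ 4"] unfolding d_def atLeastAtMost_iff by linarith
  have int: "integrable P (d k)" for k by (rule integrable_bounded[where B=1]) (use d1 in auto)
  have summ: "summable (\<lambda>k. 1 / real (Suc k) ^ 2)"
    using inverse_power_summable[of 2, where 'a=real]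
    by (subst summable_Suc_iff) (simp add: inverse_eq_divide)
  have "(\<integral>\<^sup>+\<omega>. (\<Sum>k. ennreal (d k \<omega>)) \<partial>P) = (\<Sum>k. \<integral>\<^sup>+\<omega>. ennreal (d k \<omega>) \<partial>P)"
    by (rule nn_integral_suminf) simp
  also have "\<dots> = (\<Sum>k. ennreal (LINT \<omega>|P. d k \<omega>))"
    by (simp add: nn_integral_eq_integral int nonneg)
  also have "\<dots> \<le> (\<Sum>k. ennreal (1 / real (Suc k) ^ 2))"
    using sample_mean_powers_L1[of "Suc _"] unfolding d_def
    by (intro suminf_le ennreal_leI) auto
  also have "\<dots> < \<infinity>"
    using summ by (subst suminf_ennreal2) auto
  finally have "(\<integral>\<^sup>+\<omega>. (\<Sum>k. ennreal (d k \<omega>)) \<partial>P) \<noteq> \<infinity>" by simp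
  then have "AE \<omega> in P. (\<Sum>k. ennreal (d k \<omega>)) \<noteq> \<infinity>"
    by (intro nn_integral_PInf_AE) auto
  with AE_space show ?thesis
  proof eventually_elim
    case (elim \<omega>)
    have "summable (\<lambda>k. d k \<omega>)"
      using elim nonneg by (intro summable_suminf_not_top) auto
    then have "summable (\<lambda>k. sample_mean (Suc (Suc k) ^ 4) \<omega> - sample_mean (Suc k ^ 4) \<omega>)"
      unfolding d_def by (rule summable_rabs_cancel)
    then have "convergent (\<lambda>n. sample_mean (Suc n ^ 4) \<omega> - sample_mean (Suc 0 ^ 4) \<omega>)"
      unfolding summable_iff_convergent
      using sum_lessThan_telescope[of "\<lambda>k. sample_mean (Suc k ^ 4) \<omega>"] by simp
    then have "convergent (\<lambda>n. sample_mean (Suc n ^ 4) \<omega>)"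
      by (simp add: convergent_diff_const_right_iff)
    then have "convergent (\<lambda>n. sample_mean n \<omega>)"
      using elim convergent_Suc_iff[of "\<lambda>n. sample_mean (n ^ 4) \<omega>"]
      by (intro convergent_sample_mean_of_powers) (auto simp: space_P)
    then show ?case
      using elim by (simp add: limit_frequency_def mean_converges_def convergent_LIMSEQ_iff space_P)
  qed
qed

end

section \<open>The representation of cylinder probabilities\<close>

text \<open>
  The probability that a coin with success probability \<open>\<theta>\<close> shows \<open>b\<close>, for \<open>b\<close> in \<open>{0, 1}\<close>. As a
  function of \<open>\<theta>\<close> it is affine, and at \<open>\<theta>\<close> in \<open>{0, 1}\<close> it is the indicator of \<open>\<theta> = b\<close>. Hence the
  average of the weights of the first \<open>n\<close> coordinates is the weight of the sample mean.
\<close>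

definition bernoulli_weight :: "nat \<Rightarrow> real \<Rightarrow> real" where
  "bernoulli_weight b \<theta> = \<theta> ^ b * (1 - \<theta>) ^ (1 - b)"

lemma bernoulli_weight_bounds:
  assumes "\<theta> \<in> {0..1}"
  shows "bernoulli_weight b \<theta> \<in> {0..1}"
  using assms unfolding bernoulli_weight_def
  by (auto intro!: mult_nonneg_nonneg mult_le_one power_le_one)

lemma continuous_bernoulli_weight [continuous_intros]:
  "continuous_on A (bernoulli_weight b)"
  unfolding bernoulli_weight_def by (intro continuous_intros)

lemma bernoulli_weight_binary:
  "b \<in> {0, 1} \<Longrightarrow> c = 0 \<or> c = 1 \<Longrightarrow> bernoulli_weight b (real c) = of_bool (c = b)"
  by (auto simp: bernoulli_weight_def)

lemma sum_bernoulli_weight: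
  assumes "b \<in> {0, 1}" "n \<ge> 1"
  shows "(\<Sum>t=1..n. bernoulli_weight b (real (\<omega> t))) = real n * bernoulli_weight b (sample_mean n \<omega>)"
  using assms by (auto simp: bernoulli_weight_def sample_mean_def sum_subtractf right_diff_distrib)

lemma represents_weight:
  assumes "represents \<mu> P" "n \<ge> 1" "x \<in> {1..n} \<rightarrow>\<^sub>E {0, 1}"
  shows "measure P {\<omega> \<in> space P. \<forall>t\<in>{1..n}. \<omega> t = x t}
    = (LINT \<theta>|\<mu>. (\<Prod>t=1..n. bernoulli_weight (x t) \<theta>))"
  using assms unfolding represents_def bernoulli_weight_def by blast

context exchangeable_law
begin

lemma weight_coord_bounds:
  assumes "\<omega> \<in> space seq_space" "t \<ge> 1"
  shows "0 \<le> bernoulli_weight b (real (\<omega> t))" "bernoulli_weight b (real (\<omega> t)) \<le> 1"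
  using bernoulli_weight_bounds[of "real (\<omega> t)" b] binary_coordinate[OF assms] by auto

lemma measurable_limit [measurable]: "limit_frequency \<in> borel_measurable P"
  using measurable_limit_frequency_law[OF sets_P] unfolding unit_borel_def
  by (simp add: measurable_restrict_space2_iff)

text \<open>
  The transposition of \<open>m + 1\<close> and \<open>j\<close> fixes the first \<open>m\<close> coordinates and the mean of the first
  \<open>N\<close>.
\<close>

lemma expectation_swap_weight:
  fixes h :: "real \<Rightarrow> real"
  assumes "m < j" "j \<le> N"
  shows "(LINT \<omega>|P. (\<Prod>s=1..m. bernoulli_weight (x s) (real (\<omega> s)))
            * bernoulli_weight b (real (\<omega> j)) * h (sample_mean N \<omega>))
    = (LINT \<omega>|P. (\<Prod>s=1..m. bernoulli_weight (x s) (real (\<omega> s)))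
            * bernoulli_weight b (real (\<omega> (Suc m))) * h (sample_mean N \<omega>))"
    (is "?l = ?r")
proof -
  define \<pi> where "\<pi> = Transposition.transpose (Suc m) j"
  define f :: "(nat \<Rightarrow> nat) \<Rightarrow> real" where
    "f \<omega> = (\<Prod>s=1..m. bernoulli_weight (x s) (real (\<omega> s)))
            * bernoulli_weight b (real (\<omega> (Suc m))) * h (sample_mean N \<omega>)" for \<omega>
  have \<pi>: "\<pi> permutes {1..N}"
    unfolding \<pi>_def using assms by (intro permutes_swap_id) auto
  have "sample_mean N (restrict \<omega> {1..N}) = sample_mean N \<omega>" for \<omega>
    unfolding sample_mean_def by (intro arg_cong2[where f="(/)"] sum.cong) auto
  then have dep: "f (restrict \<omega> {1..N}) = f \<omega>" for \<omega>
    unfolding f_def using assms by (intro arg_cong2[where f="(*)"] prod.cong) auto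
  have mean: "sample_mean N (\<lambda>t. \<omega> (\<pi> t)) = sample_mean N \<omega>" for \<omega>
    unfolding sample_mean_def
    by (subst sum.reindex_bij_betw[OF permutes_imp_bij[OF \<pi>], of "\<lambda>t. real (\<omega> t)"]) simp
  have fixed: "\<pi> s = s" if "s \<in> {1..m}" for s
    using that assms by (auto simp: \<pi>_def Transposition.transpose_def)
  have "f (\<lambda>t. \<omega> (\<pi> t)) = (\<Prod>s=1..m. bernoulli_weight (x s) (real (\<omega> s)))
            * bernoulli_weight b (real (\<omega> j)) * h (sample_mean N \<omega>)" for \<omega>
    unfolding f_def mean using fixed
    by (intro arg_cong2[where f="(*)"] prod.cong refl) (auto simp: \<pi>_def)
  then have "?l = (LINT \<omega>|P. f (\<lambda>t. \<omega> (\<pi> t)))" by simp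
  also have "\<dots> = (LINT \<omega>|P. f \<omega>)"
    using assms by (intro integral_permute[OF _ \<pi>] dep) auto
  finally show ?thesis by (simp add: f_def)
qed

text \<open>
  One coordinate is integrated out at a time. By the preceding lemma the factor of coordinate
  \<open>m + 1\<close> may be replaced by that of any \<open>j\<close> with \<open>m < j \<le> N\<close>, hence by their average. As \<open>N\<close> grows,
  this average tends to the weight of the limiting frequency.
\<close>

lemma expectation_replace_weight:
  fixes h :: "real \<Rightarrow> real"
  assumes b: "b \<in> {0, 1}" and h: "continuous_on UNIV h"
  shows "(LINT \<omega>|P. (\<Prod>s=1..m. bernoulli_weight (x s) (real (\<omega> s)))
            * bernoulli_weight b (real (\<omega> (Suc m))) * h (limit_frequency \<omega>))
    = (LINT \<omega>|P. (\<Prod>s=1..m. bernoulli_weight (x s) (real (\<omega> s)))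
            * bernoulli_weight b (limit_frequency \<omega>) * h (limit_frequency \<omega>))"
proof -
  define W where "W \<omega> = (\<Prod>s=1..m. bernoulli_weight (x s) (real (\<omega> s)))" for \<omega> :: "nat \<Rightarrow> nat"
  \<comment> \<open>division by \<open>N\<close> and not by the number \<open>N - m\<close> of terms: the ratio tends to \<open>1\<close>\<close>
  define A where "A N \<omega> = (\<Sum>j=Suc m..N. bernoulli_weight b (real (\<omega> j))) / real N"
    for N and \<omega> :: "nat \<Rightarrow> nat"
  define E where "E N = (LINT \<omega>|P. W \<omega> * bernoulli_weight b (real (\<omega> (Suc m))) * h (sample_mean N \<omega>))" for N
  have "compact (h ` {0..1})"
    by (rule compact_continuous_image) (auto intro: continuous_on_subset[OF h])
  then obtain B where "\<forall>\<theta>\<in>{0..1}. \<bar>h \<theta>\<bar> \<le> B"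
    using compact_imp_bounded[of "h ` {0..1}"] by (auto simp: bounded_iff)
  then have hM: "\<bar>h (sample_mean N \<omega>)\<bar> \<le> B" if "\<omega> \<in> space seq_space" for N \<omega>
    using sample_mean_unit_interval[OF that] by blast
  have [measurable]: "h \<in> borel_measurable borel" "bernoulli_weight c \<in> borel_measurable borel" for c
    using h by (auto intro!: borel_measurable_continuous_onI continuous_intros)
  have [measurable]: "(\<lambda>\<omega>. bernoulli_weight c (real (\<omega> t))) \<in> borel_measurable P" if "t \<ge> 1" for c t
    using that by (rule measurable_coord_comp)
  have [measurable]: "W \<in> borel_measurable P"
    unfolding W_def by (intro borel_measurable_prod measurable_coord_comp) auto
  have [measurable]: "A N \<in> borel_measurable P" for N
    unfolding A_def by (intro borel_measurable_divide borel_measurable_sum measurable_coord_comp) auto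
  have W1: "\<bar>W \<omega>\<bar> \<le> 1" if "\<omega> \<in> space seq_space" for \<omega>
    unfolding W_def abs_prod using weight_coord_bounds[OF that] by (intro prod_le_1) auto
  have bound: "\<bar>W \<omega> * y * h (sample_mean N \<omega>)\<bar> \<le> B"
    if "\<omega> \<in> space seq_space" "\<bar>y\<bar> \<le> 1" for \<omega> y N
  proof -
    have "\<bar>W \<omega>\<bar> * \<bar>y\<bar> * \<bar>h (sample_mean N \<omega>)\<bar> \<le> 1 * 1 * B"
      using W1 hM that by (intro mult_mono) auto
    then show ?thesis by (simp add: abs_mult)
  qed
  have A1: "\<bar>A N \<omega>\<bar> \<le> 1" if "\<omega> \<in> space seq_space" for N \<omega>
  proof -
    have "(\<Sum>j=Suc m..N. bernoulli_weight b (real (\<omega> j))) \<le> (\<Sum>j=Suc m..N. 1)"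
      using weight_coord_bounds[OF that] by (intro sum_mono) auto
    also have "\<dots> \<le> real N" by simp
    finally have "A N \<omega> \<le> 1" unfolding A_def by (cases "N = 0") auto
    moreover have "A N \<omega> \<ge> 0"
      unfolding A_def using weight_coord_bounds[OF that] by (intro divide_nonneg_nonneg sum_nonneg) auto
    ultimately show ?thesis by simp
  qed
  have avg: "(LINT \<omega>|P. W \<omega> * A N \<omega> * h (sample_mean N \<omega>)) = real (N - m) / real N * E N" for N
  proof -
    have int: "integrable P (\<lambda>\<omega>. W \<omega> * bernoulli_weight b (real (\<omega> j)) * h (sample_mean N \<omega>))"
      if "j \<in> {Suc m..N}" for j
      by (rule integrable_bounded[where B=B])
        (use that in \<open>auto intro!: bound borel_measurable_times measurable_coord_comp simp: weight_coord_bounds\<close>)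
    have "(LINT \<omega>|P. W \<omega> * A N \<omega> * h (sample_mean N \<omega>))
      = (LINT \<omega>|P. (\<Sum>j=Suc m..N. W \<omega> * bernoulli_weight b (real (\<omega> j)) * h (sample_mean N \<omega>)) / real N)"
      by (simp add: A_def sum_distrib_left sum_distrib_right)
    also have "\<dots> = (\<Sum>j=Suc m..N. LINT \<omega>|P. W \<omega> * bernoulli_weight b (real (\<omega> j)) * h (sample_mean N \<omega>)) / real N"
      using int by simp
    also have "\<dots> = (\<Sum>j=Suc m..N. E N) / real N"
      unfolding E_def W_def by (intro arg_cong2[where f="(/)"] sum.cong refl expectation_swap_weight) auto
    finally show ?thesis by simp
  qed
  have lim_mean: "AE \<omega> in P. \<omega> \<in> space seq_space \<and> (\<lambda>N. sample_mean N \<omega>) \<longlonglongrightarrow> limit_frequency \<omega>"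
    using AE_sample_mean_converges AE_space by eventually_elim (simp add: space_P)
  have h_lim: "(\<lambda>N. h (sample_mean N \<omega>)) \<longlonglongrightarrow> h (limit_frequency \<omega>)"
    if "(\<lambda>N. sample_mean N \<omega>) \<longlonglongrightarrow> limit_frequency \<omega>" for \<omega>
    using continuous_on_tendsto_compose[OF h that] by simp
  have A_lim: "(\<lambda>N. A N \<omega>) \<longlonglongrightarrow> bernoulli_weight b (limit_frequency \<omega>)"
    if lim: "(\<lambda>N. sample_mean N \<omega>) \<longlonglongrightarrow> limit_frequency \<omega>" for \<omega>
  proof -
    define R where "R = (\<Sum>j=1..m. bernoulli_weight b (real (\<omega> j)))"
    have "(\<lambda>N. bernoulli_weight b (sample_mean N \<omega>) - R / real N) \<longlonglongrightarrow> bernoulli_weight b (limit_frequency \<omega>) - 0"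
      using continuous_on_tendsto_compose[OF continuous_bernoulli_weight[of UNIV b] lim]
      by (intro tendsto_diff lim_const_over_n) auto
    moreover have "\<forall>\<^sub>F N in sequentially. bernoulli_weight b (sample_mean N \<omega>) - R / real N = A N \<omega>"
      using eventually_ge_at_top[of "Suc m"]
    proof eventually_elim
      case (elim N)
      have "{1..N} = {1..m} \<union> {Suc m..N}" using elim by auto
      then have "(\<Sum>t=1..N. bernoulli_weight b (real (\<omega> t))) = R + real N * A N \<omega>"
        unfolding R_def A_def using elim by (simp only:) (subst sum.union_disjoint; auto)
      moreover have "N \<ge> 1" using elim by simp
      ultimately show ?case
        using sum_bernoulli_weight[OF b, of N \<omega>] by (simp add: field_simps)
    qed
    ultimately show ?thesis by (simp cong: filterlim_cong)
  qed
  have "(\<lambda>N. real (N - m) / real N * E N) \<longlonglongrightarrow>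
      (LINT \<omega>|P. W \<omega> * bernoulli_weight b (limit_frequency \<omega>) * h (limit_frequency \<omega>))"
    unfolding avg[symmetric]
  proof (rule integral_dominated_convergence[where w="\<lambda>_. B"])
    show "AE \<omega> in P. (\<lambda>N. W \<omega> * A N \<omega> * h (sample_mean N \<omega>)) \<longlonglongrightarrow>
        W \<omega> * bernoulli_weight b (limit_frequency \<omega>) * h (limit_frequency \<omega>)"
      using lim_mean by eventually_elim (intro tendsto_intros A_lim h_lim; simp)
    show "AE \<omega> in P. norm (W \<omega> * A N \<omega> * h (sample_mean N \<omega>)) \<le> B" for N
      using lim_mean by eventually_elim (use bound A1 in auto)
  qed auto
  moreover have "(\<lambda>N. real (N - m) / real N * E N) \<longlonglongrightarrow>
      1 * (LINT \<omega>|P. W \<omega> * bernoulli_weight b (real (\<omega> (Suc m))) * h (limit_frequency \<omega>))"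
  proof (rule tendsto_mult)
    show "(\<lambda>N. real (N - m) / real N) \<longlonglongrightarrow> 1" by real_asymp
    show "E \<longlonglongrightarrow> (LINT \<omega>|P. W \<omega> * bernoulli_weight b (real (\<omega> (Suc m))) * h (limit_frequency \<omega>))"
      unfolding E_def
    proof (rule integral_dominated_convergence[where w="\<lambda>_. B"])
      show "AE \<omega> in P. (\<lambda>N. W \<omega> * bernoulli_weight b (real (\<omega> (Suc m))) * h (sample_mean N \<omega>)) \<longlonglongrightarrow>
          W \<omega> * bernoulli_weight b (real (\<omega> (Suc m))) * h (limit_frequency \<omega>)"
        using lim_mean by eventually_elim (intro tendsto_intros h_lim; simp)
      show "AE \<omega> in P. norm (W \<omega> * bernoulli_weight b (real (\<omega> (Suc m))) * h (sample_mean N \<omega>)) \<le> B" for N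
        using lim_mean by eventually_elim (auto intro!: bound simp: weight_coord_bounds)
    qed auto
  qed
  ultimately show ?thesis
    unfolding W_def by (simp add: LIMSEQ_unique)
qed

lemma expectation_weights:
  fixes h :: "real \<Rightarrow> real"
  assumes x: "\<And>t. t \<in> {1..n} \<Longrightarrow> x t \<in> {0, 1}" and h: "continuous_on UNIV h"
  shows "(LINT \<omega>|P. (\<Prod>t=1..n. bernoulli_weight (x t) (real (\<omega> t))) * h (limit_frequency \<omega>))
    = (LINT \<omega>|P. (\<Prod>t=1..n. bernoulli_weight (x t) (limit_frequency \<omega>)) * h (limit_frequency \<omega>))"
  using x h
proof (induction n arbitrary: h)
  case (Suc n)
  define g where "g \<theta> = bernoulli_weight (x (Suc n)) \<theta> * h \<theta>" for \<theta>
  have g: "continuous_on UNIV g"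
    unfolding g_def using Suc.prems by (intro continuous_intros) auto
  have "x (Suc n) \<in> {0, 1}" using Suc.prems(1)[of "Suc n"] by simp
  from expectation_replace_weight[OF this Suc.prems(2), where m=n and x=x]
  show ?case
    using Suc.IH[OF _ g] Suc.prems(1) by (simp add: g_def mult_ac)
qed simp

lemma represents_limit_frequency:
  "represents (distr P unit_borel limit_frequency) P"
  unfolding represents_def
proof (intro conjI allI impI ballI)
  have L: "limit_frequency \<in> P \<rightarrow>\<^sub>M unit_borel"
    using sets_P by (rule measurable_limit_frequency_law)
  show "prob_space (distr P unit_borel limit_frequency)"
    using L by (rule prob_space_distr)
  fix n :: nat and x :: "nat \<Rightarrow> nat" assume "n \<ge> 1" and x: "x \<in> {1..n} \<rightarrow>\<^sub>E {0, 1}"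
  define C where "C = {\<omega> \<in> space P. \<forall>t\<in>{1..n}. \<omega> t = x t}"
  have C: "C \<in> sets P"
    unfolding C_def space_P sets_P using x \<open>n \<ge> 1\<close> by (rule sets_cylinder)
  have "(\<Prod>t=1..n. bernoulli_weight (x t) (real (\<omega> t))) = indicator C \<omega>" if "\<omega> \<in> space P" for \<omega>
  proof -
    have "(\<Prod>t=1..n. bernoulli_weight (x t) (real (\<omega> t))) = (\<Prod>t=1..n. of_bool (\<omega> t = x t))"
      using that x by (intro prod.cong refl bernoulli_weight_binary binary_coordinate)
        (auto simp: space_P PiE_iff)
    also have "\<dots> = indicator C \<omega>"
      using that by (auto simp: C_def indicator_def prod_zero_iff)
    finally show ?thesis .
  qed
  then have "measure P C = (LINT \<omega>|P. (\<Prod>t=1..n. bernoulli_weight (x t) (real (\<omega> t))))"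
    using C by (simp cong: Bochner_Integration.integral_cong)
  also have "\<dots> = (LINT \<omega>|P. (\<Prod>t=1..n. bernoulli_weight (x t) (limit_frequency \<omega>)))"
    using expectation_weights[of n x "\<lambda>_. 1"] x by (auto simp: PiE_iff)
  also have "\<dots> = (LINT \<theta>|distr P unit_borel limit_frequency. (\<Prod>t=1..n. bernoulli_weight (x t) \<theta>))"
    by (rule integral_distr[symmetric, OF L])
      (auto simp: unit_borel_def intro!: measurable_restrict_space1 borel_measurable_continuous_onI continuous_intros)
  finally show "measure P {\<omega> \<in> space P. \<forall>t\<in>{1..n}. \<omega> t = x t}
      = (LINT \<theta>|distr P unit_borel limit_frequency. (\<Prod>t=1..n. \<theta> ^ x t * (1 - \<theta>) ^ (1 - x t)))"
    unfolding C_def bernoulli_weight_def .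
qed simp

end

section \<open>Moments determine a law on the unit interval\<close>

text \<open>
  The Taylor expansion of the characteristic function converges for laws on the unit interval, so
  equal moments give equal characteristic functions, and Levy's uniqueness theorem applies after the
  laws are transported to the real line.
\<close>

lemma unit_borel_eqI_moments:
  assumes \<mu>: "prob_space \<mu>" "sets \<mu> = sets unit_borel"
    and \<nu>: "prob_space \<nu>" "sets \<nu> = sets unit_borel"
    and mom: "\<And>k. (LINT \<theta>|\<mu>. \<theta> ^ k) = (LINT \<theta>|\<nu>. \<theta> ^ k)"
  shows "\<mu> = \<nu>"
proof -
  have emb: "(\<lambda>\<theta>. \<theta>) \<in> \<kappa> \<rightarrow>\<^sub>M borel" if "sets \<kappa> = sets unit_borel" for \<kappa> :: "real measure"
    unfolding measurable_cong_sets[OF that refl] unit_borel_def by (rule measurable_restrict_space1) simp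
  have space: "space \<kappa> = {0..1}" if "sets \<kappa> = sets unit_borel" for \<kappa> :: "real measure"
    using sets_eq_imp_space_eq[OF that] by (simp add: unit_borel_def)
  define E where "E \<kappa> = distr \<kappa> borel (\<lambda>\<theta>::real. \<theta>)" for \<kappa> :: "real measure"
  have real: "real_distribution (E \<kappa>)" if "prob_space \<kappa>" "sets \<kappa> = sets unit_borel" for \<kappa>
    unfolding E_def using that emb by (intro prob_space.real_distribution_distr)
  have E_mom: "(LINT y|E \<kappa>. y ^ k) = (LINT \<theta>|\<kappa>. \<theta> ^ k)" if "sets \<kappa> = sets unit_borel" for \<kappa> k
    unfolding E_def by (subst integral_distr[OF emb[OF that]]) auto
  have approx: "cmod (char (E \<kappa>) t - (\<Sum>k\<le>n. ((\<i> * t) ^ k / fact k) * (LINT \<theta>|\<kappa>. \<theta> ^ k)))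
      \<le> 2 * (\<bar>t\<bar> ^ n / fact n)" if \<kappa>: "prob_space \<kappa>" "sets \<kappa> = sets unit_borel" for \<kappa> n and t :: real
  proof -
    interpret R: real_distribution "E \<kappa>" using real[OF \<kappa>] .
    have AE: "AE y in E \<kappa>. y \<in> {0..1}"
      unfolding E_def using emb[OF \<kappa>(2)] by (subst AE_distr_iff) (auto simp: space[OF \<kappa>(2)])
    have int: "integrable (E \<kappa>) (\<lambda>y. y ^ k)" for k
    proof (rule R.integrable_const_bound[where B=1])
      show "AE y in E \<kappa>. norm (y ^ k) \<le> 1"
        using AE by eventually_elim (auto intro: power_le_one)
    qed simp
    have int_abs: "integrable (E \<kappa>) (\<lambda>y. \<bar>y\<bar> ^ n)"
      using integrable_abs[OF int[of n]] by (simp add: power_abs)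
    have "(LINT y|E \<kappa>. \<bar>y\<bar> ^ n) \<le> (LINT y|E \<kappa>. 1)"
    proof (rule integral_mono_AE[OF int_abs])
      show "AE y in E \<kappa>. \<bar>y\<bar> ^ n \<le> 1"
        using AE by eventually_elim (auto intro: power_le_one)
    qed simp
    then have "(LINT y|E \<kappa>. \<bar>y\<bar> ^ n) \<le> 1"
      using R.prob_space by simp
    then have "(2 * \<bar>t\<bar> ^ n / fact n) * (LINT y|E \<kappa>. \<bar>y\<bar> ^ n) \<le> (2 * \<bar>t\<bar> ^ n / fact n) * 1"
      by (intro mult_left_mono) auto
    with R.char_approx1[of n t, OF int] show ?thesis
      by (simp add: E_mom[OF \<kappa>(2)])
  qed
  have "char (E \<mu>) t = char (E \<nu>) t" for t
  proof -
    have "(\<lambda>n. \<bar>t\<bar> ^ n / fact n) \<longlonglongrightarrow> 0"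
      using summable_LIMSEQ_zero[OF summable_exp[of "\<bar>t\<bar>"]] by (simp add: field_simps)
    then have lim: "(\<lambda>n. 4 * (\<bar>t\<bar> ^ n / fact n)) \<longlonglongrightarrow> 0"
      using tendsto_mult_right_zero by blast
    have "cmod (char (E \<mu>) t - char (E \<nu>) t) \<le> 4 * (\<bar>t\<bar> ^ n / fact n)" for n
    proof -
      let ?s = "\<Sum>k\<le>n. ((\<i> * t) ^ k / fact k) * (LINT \<theta>|\<mu>. \<theta> ^ k)"
      have "cmod (char (E \<mu>) t - char (E \<nu>) t) \<le> cmod (char (E \<mu>) t - ?s) + cmod (char (E \<nu>) t - ?s)"
        using norm_triangle_ineq4[of "char (E \<mu>) t - ?s" "char (E \<nu>) t - ?s"] by simp
      then show ?thesis
        using approx[OF \<mu>, of t n] approx[OF \<nu>, of t n] by (simp add: mom)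
    qed
    then have "cmod (char (E \<mu>) t - char (E \<nu>) t) \<le> 0"
      by (intro LIMSEQ_le_const[OF lim]) auto
    then show ?thesis by simp
  qed
  then have E_eq: "E \<mu> = E \<nu>"
    using real \<mu> \<nu> by (intro Levy_uniqueness) auto
  show ?thesis
  proof (rule measure_eqI)
    fix A assume "A \<in> sets \<mu>"
    then have A: "A \<in> sets borel" "A \<subseteq> {0..1}"
      using \<mu>(2) by (auto simp: unit_borel_def sets_restrict_space_iff)
    have "emeasure (E \<kappa>) A = emeasure \<kappa> A" if "sets \<kappa> = sets unit_borel" for \<kappa>
      unfolding E_def using emeasure_distr[OF emb[OF that] A(1)] A(2) space[OF that]
      by (simp add: Int_absorb2)
    then show "emeasure \<mu> A = emeasure \<nu> A"
      using \<mu> \<nu> E_eq by metis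
  qed (use \<mu> \<nu> in simp)
qed

text \<open>
  The \<open>k\<close>-th moment of a mixing measure is the probability that the first \<open>k\<close> coordinates are \<open>1\<close>.
\<close>

lemma represents_unique:
  assumes \<mu>: "represents \<mu> P" and \<nu>: "represents \<nu> P"
  shows "\<mu> = \<nu>"
proof (rule unit_borel_eqI_moments)
  fix k
  have mom: "(LINT \<theta>|\<kappa>. \<theta> ^ k) = measure P {\<omega> \<in> space P. \<forall>t\<in>{1..k}. \<omega> t = (\<lambda>t\<in>{1..k}. 1) t}"
    if "represents \<kappa> P" "k \<ge> 1" for \<kappa>
    by (subst represents_weight[OF that]) (auto simp: bernoulli_weight_def)
  show "(LINT \<theta>|\<mu>. \<theta> ^ k) = (LINT \<theta>|\<nu>. \<theta> ^ k)"
  proof (cases "k = 0")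
    case True
    then show ?thesis
      using \<mu> \<nu> by (simp add: represents_def prob_space.prob_space)
  qed (use mom[OF \<mu>] mom[OF \<nu>] in simp)
qed (use \<mu> \<nu> in \<open>auto simp: represents_def\<close>)

section \<open>The mixing measure is the law of the limiting frequency\<close>

lemma de_finetti:
  assumes "probability_law P" "exchangeable P"
  shows "de_finetti_mixing_measure P (distr P unit_borel limit_frequency)"
proof -
  interpret exchangeable_law P
    using assms by (simp add: exchangeable_law_def exchangeable_law_axioms_def probability_law_def)
  show ?thesis
    unfolding de_finetti_mixing_measure_def
    using represents_limit_frequency represents_unique by blast
qed

lemma measure_limit_frequency_eq:
  assumes P: "probability_law P" and p: "p \<in> {0..1}"
  shows "measure P {\<omega> \<in> space P. limit_frequency \<omega> = p}
    = measure (distr P unit_borel limit_frequency) {p}"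
proof -
  have "limit_frequency \<in> P \<rightarrow>\<^sub>M unit_borel"
    using P by (auto simp: probability_law_def intro: measurable_limit_frequency_law)
  moreover have "{p} \<in> sets unit_borel"
    using p by (auto simp: unit_borel_def sets_restrict_space_iff)
  ultimately show ?thesis
    by (subst measure_distr) (auto intro!: arg_cong[where f="measure P"])
qed

section \<open>Mixtures of two coin-tossing laws\<close>

text \<open>
  The representing integrand is a product over the coordinates and therefore symmetric, so cylinder
  probabilities are invariant under permutation of the prescribed values.
\<close>

lemma exchangeable_of_represents:
  assumes P: "probability_law P" and rep: "represents \<mu> P"
  shows "exchangeable P"
  unfolding exchangeable_def
proof (intro allI impI)
  fix n \<pi> assume n: "n \<ge> (1::nat)" and \<pi>: "\<pi> permutes {1..n}"
  interpret prob_space P using P by (simp add: probability_law_def)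
  have sets: "sets P = sets seq_space" using P by (simp add: probability_law_def)
  have \<pi>1: "\<pi> t \<ge> 1" if "t \<in> {1..n}" for t
    using permutes_in_image[OF \<pi>, of t] that by auto
  have word: "(\<lambda>\<omega>. \<lambda>t\<in>{1..n}. \<omega> (\<sigma> t)) \<in> P \<rightarrow>\<^sub>M word_space n"
    if "\<And>t. t \<in> {1..n} \<Longrightarrow> \<sigma> t \<ge> 1" for \<sigma>
    unfolding measurable_cong_sets[OF sets refl] word_space_def seq_space_def using that
    by (intro measurable_restrict measurable_component_singleton) auto
  define Q where "Q \<sigma> = distr P (word_space n) (\<lambda>\<omega>. \<lambda>t\<in>{1..n}. \<omega> (\<sigma> t))" for \<sigma>
  have Q: "measure (Q \<sigma>) {x} = measure P {\<omega> \<in> space P. \<forall>t\<in>{1..n}. \<omega> (\<sigma> t) = x t}"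
    if "\<And>t. t \<in> {1..n} \<Longrightarrow> \<sigma> t \<ge> 1" and x: "x \<in> {1..n} \<rightarrow>\<^sub>E {0, 1}" for \<sigma> x
  proof -
    have "(\<lambda>t\<in>{1..n}. \<omega> (\<sigma> t)) = x \<longleftrightarrow> (\<forall>t\<in>{1..n}. \<omega> (\<sigma> t) = x t)" for \<omega>
      using x by (auto simp: fun_eq_iff PiE_iff extensional_def restrict_def)
    then show ?thesis
      unfolding Q_def using x
      by (subst measure_distr[OF word[OF that(1)]])
        (auto simp: word_space_eq vimage_def Int_def conj_commute intro!: arg_cong[where f="measure P"])
  qed
  have "Q (\<lambda>t. t) = Q \<pi>"
  proof (rule measure_eqI_finite)
    show "sets (Q (\<lambda>t. t)) = Pow ({1..n} \<rightarrow>\<^sub>E {0, 1})" "sets (Q \<pi>) = Pow ({1..n} \<rightarrow>\<^sub>E {0, 1})"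
      by (simp_all add: Q_def word_space_eq)
    show "finite ({1..n} \<rightarrow>\<^sub>E {0, 1 :: nat})" by (intro finite_PiE) auto
    fix x :: "nat \<Rightarrow> nat" assume x: "x \<in> {1..n} \<rightarrow>\<^sub>E {0, 1}"
    define y where "y = (\<lambda>t\<in>{1..n}. x (inv \<pi> t))"
    have inv: "inv \<pi> permutes {1..n}" by (rule permutes_inv[OF \<pi>])
    have y: "y \<in> {1..n} \<rightarrow>\<^sub>E {0, 1}"
      using x permutes_in_image[OF inv] by (auto simp: y_def PiE_iff)
    have "(\<forall>t\<in>{1..n}. \<omega> (\<pi> t) = x t) \<longleftrightarrow> (\<forall>t\<in>{1..n}. \<omega> t = y t)" for \<omega>
    proof -
      have "(\<forall>t\<in>{1..n}. \<omega> t = y t) \<longleftrightarrow> (\<forall>t\<in>\<pi> ` {1..n}. \<omega> t = y t)"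
        by (simp only: permutes_image[OF \<pi>])
      also have "\<dots> \<longleftrightarrow> (\<forall>t\<in>{1..n}. \<omega> (\<pi> t) = x t)"
        using permutes_in_image[OF \<pi>] permutes_inverses(2)[OF \<pi>] by (simp add: y_def)
      finally show ?thesis by simp
    qed
    then have "measure (Q \<pi>) {x} = (LINT \<theta>|\<mu>. (\<Prod>t=1..n. bernoulli_weight (y t) \<theta>))"
      using Q[OF \<pi>1 x] represents_weight[OF rep n y] by simp
    also have "\<dots> = (LINT \<theta>|\<mu>. (\<Prod>t=1..n. bernoulli_weight (x t) \<theta>))"
    proof -
      have "(\<Prod>t=1..n. bernoulli_weight (y t) \<theta>) = (\<Prod>t=1..n. bernoulli_weight (x (inv \<pi> t)) \<theta>)" for \<theta>
        by (intro prod.cong) (auto simp: y_def)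
      then show ?thesis
        using prod.reindex_bij_betw[OF permutes_imp_bij[OF inv], of "\<lambda>t. bernoulli_weight (x t) _"]
        by simp
    qed
    also have "\<dots> = measure (Q (\<lambda>t. t)) {x}"
      using Q[of "\<lambda>t. t", OF _ x] represents_weight[OF rep n x] by simp
    finally have "measure (Q (\<lambda>t. t)) {x} = measure (Q \<pi>) {x}" by simp
    moreover have "prob_space (Q \<sigma>)" if "\<And>t. t \<in> {1..n} \<Longrightarrow> \<sigma> t \<ge> 1" for \<sigma>
      unfolding Q_def by (rule prob_space_distr[OF word[OF that]])
    then have "finite_measure (Q (\<lambda>t. t))" "finite_measure (Q \<pi>)"
      using \<pi>1 by (auto intro: prob_space.finite_measure)
    ultimately show "emeasure (Q (\<lambda>t. t)) {x} = emeasure (Q \<pi>) {x}"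
      by (simp add: finite_measure.emeasure_eq_measure)
  qed
  then show "distr P (word_space n) (\<lambda>\<omega>. \<lambda>t\<in>{1..n}. \<omega> t)
      = distr P (word_space n) (\<lambda>\<omega>. \<lambda>t\<in>{1..n}. \<omega> (\<pi> t))"
    by (simp add: Q_def)
qed

text \<open>
  One toss of a coin with success probability \<open>\<theta>\<close>, as a law on \<open>{0, 1}\<close>.
\<close>

definition coin :: "real \<Rightarrow> nat measure" where
  "coin \<theta> = distr (measure_pmf (bernoulli_pmf \<theta>)) (count_space {0, 1}) of_bool"

text \<open>
  The law of independent tosses of that coin.
\<close>

definition coin_law :: "real \<Rightarrow> (nat \<Rightarrow> nat) measure" where
  "coin_law \<theta> = PiM {1..} (\<lambda>_. coin \<theta>)"

text \<open>
  The coin is first chosen at random, with parameter \<open>p\<close> with probability \<open>\<alpha>\<close> and parameter \<open>q\<close>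
  otherwise, and is then tossed for ever.
\<close>

definition two_coin_law :: "real \<Rightarrow> real \<Rightarrow> real \<Rightarrow> (nat \<Rightarrow> nat) measure" where
  "two_coin_law \<alpha> p q = measure_pmf (bernoulli_pmf \<alpha>) \<bind> (\<lambda>b. coin_law (if b then p else q))"

text \<open>
  The law of the parameter of the chosen coin.
\<close>

definition two_point_measure :: "real \<Rightarrow> real \<Rightarrow> real \<Rightarrow> real measure" where
  "two_point_measure \<alpha> p q = distr (measure_pmf (bernoulli_pmf \<alpha>)) unit_borel (\<lambda>b. if b then p else q)"

lemma sets_coin [simp]: "sets (coin \<theta>) = Pow {0, 1}"
  by (simp add: coin_def)

lemma of_bool_measurable: "of_bool \<in> measure_pmf D \<rightarrow>\<^sub>M count_space {0, 1 :: nat}"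
  by auto

lemma prob_space_coin: "prob_space (coin \<theta>)"
  unfolding coin_def by (rule measure_pmf.prob_space_distr[OF of_bool_measurable])

lemma measure_coin:
  assumes "\<theta> \<in> {0..1}" "b \<in> {0, 1}"
  shows "measure (coin \<theta>) {b} = bernoulli_weight b \<theta>"
proof -
  have pre: "of_bool -` {b} \<inter> space (measure_pmf (bernoulli_pmf \<theta>)) = {b = 1}"
    using assms(2) by (elim insertE) (auto simp del: One_nat_def)
  have "measure (coin \<theta>) {b} = measure (measure_pmf (bernoulli_pmf \<theta>)) {b = 1}"
    unfolding coin_def pre[symmetric]
    by (rule measure_distr[OF of_bool_measurable]) (use assms(2) in simp)
  also have "\<dots> = pmf (bernoulli_pmf \<theta>) (b = 1)"
    by (rule measure_pmf_single)
  also have "\<dots> = bernoulli_weight b \<theta>"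
    using assms by (elim insertE) (simp_all add: bernoulli_weight_def)
  finally show ?thesis .
qed

lemma sets_coin_law: "sets (coin_law \<theta>) = sets seq_space"
  unfolding coin_law_def seq_space_def by (intro sets_PiM_cong) auto

lemma prob_space_coin_law: "prob_space (coin_law \<theta>)"
  unfolding coin_law_def by (intro prob_space_PiM prob_space_coin)

lemma measure_coin_law_cylinder:
  assumes \<theta>: "\<theta> \<in> {0..1}" and x: "x \<in> {1..n} \<rightarrow>\<^sub>E {0, 1}"
  shows "measure (coin_law \<theta>) {\<omega> \<in> space seq_space. \<forall>t\<in>{1..n}. \<omega> t = x t}
    = (\<Prod>t=1..n. bernoulli_weight (x t) \<theta>)"
proof -
  interpret product_prob_space "\<lambda>_. coin \<theta>" "{1..}"
    by (rule product_prob_spaceI) (rule prob_space_coin)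
  have "{\<omega> \<in> space seq_space. \<forall>t\<in>{1..n}. \<omega> t = x t}
      = prod_emb {1..} (\<lambda>_. coin \<theta>) {1..n} (\<Pi>\<^sub>E t\<in>{1..n}. {x t})"
    by (auto simp: prod_emb_def restrict_PiE_iff Pi_iff coin_def seq_space_def space_PiM)
  also have "measure (coin_law \<theta>) \<dots> = (\<Prod>t=1..n. measure (coin \<theta>) {x t})"
    unfolding coin_law_def using x by (intro measure_PiM_emb) (auto simp: PiE_iff)
  also have "\<dots> = (\<Prod>t=1..n. bernoulli_weight (x t) \<theta>)"
    using x by (intro prod.cong refl measure_coin[OF \<theta>]) (auto simp: PiE_iff)
  finally show ?thesis .
qed

lemma coin_law_kernel:
  "(\<lambda>b. coin_law (f b)) \<in> measure_pmf D \<rightarrow>\<^sub>M subprob_algebra seq_space"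
  by (auto simp: measurable_def space_subprob_algebra sets_coin_law
      intro!: prob_space_imp_subprob_space prob_space_coin_law)

lemma sets_two_coin_law: "sets (two_coin_law \<alpha> p q) = sets seq_space"
  unfolding two_coin_law_def by (rule sets_bind) (auto simp: sets_coin_law)

lemma probability_law_two_coin_law: "probability_law (two_coin_law \<alpha> p q)"
proof -
  have "prob_space (two_coin_law \<alpha> p q)"
    unfolding two_coin_law_def
    by (rule measure_pmf.prob_space_bind[OF _ coin_law_kernel]) (auto intro: prob_space_coin_law)
  then show ?thesis
    by (simp add: probability_law_def sets_two_coin_law)
qed

lemma two_point_measurable:
  assumes "p \<in> {0..1}" "q \<in> {0..1}"
  shows "(\<lambda>b. if b then p else q) \<in> measure_pmf D \<rightarrow>\<^sub>M unit_borel"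
  using assms by (auto simp: measurable_def unit_borel_def)

lemma represents_two_coin_law:
  assumes \<alpha>: "\<alpha> \<in> {0..1}" and pq: "p \<in> {0..1}" "q \<in> {0..1}"
  shows "represents (two_point_measure \<alpha> p q) (two_coin_law \<alpha> p q)"
  unfolding represents_def bernoulli_weight_def[symmetric]
proof (intro conjI allI impI ballI)
  show "prob_space (two_point_measure \<alpha> p q)"
    unfolding two_point_measure_def by (rule measure_pmf.prob_space_distr[OF two_point_measurable[OF pq]])
  fix n :: nat and x :: "nat \<Rightarrow> nat" assume n: "n \<ge> 1" and x: "x \<in> {1..n} \<rightarrow>\<^sub>E {0, 1}"
  define C where "C = {\<omega> \<in> space seq_space. \<forall>t\<in>{1..n}. \<omega> t = x t}"
  have C: "C \<in> sets seq_space"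
    unfolding C_def using x n by (rule sets_cylinder)
  have space: "space (two_coin_law \<alpha> p q) = space seq_space"
    by (rule sets_eq_imp_space_eq[OF sets_two_coin_law])
  have "measure (two_coin_law \<alpha> p q) C
      = (LINT b|bernoulli_pmf \<alpha>. measure (coin_law (if b then p else q)) C)"
    unfolding two_coin_law_def by (rule measure_pmf.measure_bind[OF coin_law_kernel C])
  also have "\<dots> = (LINT b|bernoulli_pmf \<alpha>. (\<Prod>t=1..n. bernoulli_weight (x t) (if b then p else q)))"
    using pq x by (intro Bochner_Integration.integral_cong refl)
      (simp add: C_def measure_coin_law_cylinder del: One_nat_def)
  also have "\<dots> = (LINT \<theta>|two_point_measure \<alpha> p q. (\<Prod>t=1..n. bernoulli_weight (x t) \<theta>))"
    unfolding two_point_measure_def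
    by (rule integral_distr[symmetric, OF two_point_measurable[OF pq]])
      (auto simp: unit_borel_def intro!: measurable_restrict_space1 borel_measurable_continuous_onI continuous_intros)
  finally show "measure (two_coin_law \<alpha> p q)
        {\<omega> \<in> space (two_coin_law \<alpha> p q). \<forall>t\<in>{1..n}. \<omega> t = x t}
      = (LINT \<theta>|two_point_measure \<alpha> p q. (\<Prod>t=1..n. bernoulli_weight (x t) \<theta>))"
    by (simp add: C_def space)
qed (simp add: two_point_measure_def)

lemma measure_two_point_measure:
  assumes "\<alpha> \<in> {0..1}" "p \<in> {0..1}" "q \<in> {0..1}" "q \<noteq> p"
  shows "measure (two_point_measure \<alpha> p q) {p} = \<alpha>"
proof -
  have "{p} \<in> sets unit_borel"
    using assms by (auto simp: unit_borel_def sets_restrict_space_iff)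
  moreover have vim: "(\<lambda>b. if b then p else q) -` {p} = {True}"
    using assms(4) by (auto split: if_splits)
  ultimately have "measure (two_point_measure \<alpha> p q) {p} = measure (measure_pmf (bernoulli_pmf \<alpha>)) {True}"
    unfolding two_point_measure_def
    by (subst measure_distr[OF two_point_measurable]) (use assms vim in auto)
  then show ?thesis
    using assms by (simp add: measure_pmf_single)
qed

lemma two_coin_law_atom:
  assumes "\<alpha> \<in> {0..1}" "p \<in> {0..1}" "q \<in> {0..1}" "q \<noteq> p"
  shows "exchangeable (two_coin_law \<alpha> p q)"
    and "measure (two_coin_law \<alpha> p q) {\<omega> \<in> space (two_coin_law \<alpha> p q). limit_frequency \<omega> = p} = \<alpha>"
proof -
  let ?P = "two_coin_law \<alpha> p q"
  have rep: "represents (two_point_measure \<alpha> p q) ?P"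
    by (rule represents_two_coin_law[OF assms(1-3)])
  show ex: "exchangeable ?P"
    by (rule exchangeable_of_represents[OF probability_law_two_coin_law rep])
  have "two_point_measure \<alpha> p q = distr ?P unit_borel limit_frequency"
    using de_finetti[OF probability_law_two_coin_law ex] rep
    by (auto simp: de_finetti_mixing_measure_def)
  then show "measure ?P {\<omega> \<in> space ?P. limit_frequency \<omega> = p} = \<alpha>"
    using measure_limit_frequency_eq[OF probability_law_two_coin_law assms(2)]
      measure_two_point_measure[OF assms] by simp
qed

text \<open>
  The two mixing measures differ in their means \<open>\<alpha> p\<close> and \<open>\<alpha> p + (1 - \<alpha>)\<close>.
\<close>

lemma two_coin_law_neq:
  assumes "\<alpha> \<in> {0<..<1}" "p \<in> {0<..<1}"
  shows "two_coin_law \<alpha> p 0 \<noteq> two_coin_law \<alpha> p 1"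
proof
  assume eq: "two_coin_law \<alpha> p 0 = two_coin_law \<alpha> p 1"
  have "represents (two_point_measure \<alpha> p q) (two_coin_law \<alpha> p q)" if "q \<in> {0..1}" for q
    using assms that by (intro represents_two_coin_law) auto
  from this[of 0] this[of 1] have "two_point_measure \<alpha> p 0 = two_point_measure \<alpha> p 1"
    unfolding eq by (intro represents_unique) auto
  moreover have "(LINT \<theta>|two_point_measure \<alpha> p q. \<theta>) = \<alpha> * p + (1 - \<alpha>) * q" if "q \<in> {0..1}" for q
  proof -
    have "(LINT \<theta>|two_point_measure \<alpha> p q. \<theta>) = (LINT b|bernoulli_pmf \<alpha>. (if b then p else q))"
      unfolding two_point_measure_def
      by (rule integral_distr[OF two_point_measurable])
        (use assms that in \<open>auto simp: unit_borel_def intro!: measurable_restrict_space1\<close>)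
    then show ?thesis
      using assms by (simp add: mult.commute)
  qed
  ultimately have "\<alpha> * p + (1 - \<alpha>) * 0 = \<alpha> * p + (1 - \<alpha>) * 1"
    by (metis atLeastAtMost_iff order_refl zero_le_one)
  then show False
    using assms by simp
qed

theorem proposition3:
  shows "(\<forall>P. probability_law P \<and> exchangeable P \<longrightarrow>
            (\<exists>\<mu>. de_finetti_mixing_measure P \<mu> \<and>
               (\<exists>\<Theta> \<in> P \<rightarrow>\<^sub>M unit_borel.
                  (AE \<omega> in P. (\<lambda>n. sample_mean n \<omega>) \<longlonglongrightarrow> \<Theta> \<omega>) \<and>
                  distr P unit_borel \<Theta> = \<mu>) \<and>
               (\<forall>p\<in>{0..1}. measure P {\<omega> \<in> space P. limit_frequency \<omega> = p} = measure \<mu> {p})))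
       \<and>
         (\<forall>p\<in>{0<..<1}. \<forall>\<alpha>\<in>{0<..<1}.
            \<exists>P1 P2.
               probability_law P1 \<and> exchangeable P1 \<and>
               probability_law P2 \<and> exchangeable P2 \<and>
               P1 \<noteq> P2 \<and>
               measure P1 {\<omega> \<in> space P1. limit_frequency \<omega> = p} = \<alpha> \<and>
               measure P2 {\<omega> \<in> space P2. limit_frequency \<omega> = p} = \<alpha>)"
proof (intro conjI allI ballI impI)
  fix P assume P: "probability_law P \<and> exchangeable P"
  interpret exchangeable_law P
    using P by (simp add: exchangeable_law_def exchangeable_law_axioms_def probability_law_def)
  let ?\<mu> = "distr P unit_borel limit_frequency"
  have "limit_frequency \<in> P \<rightarrow>\<^sub>M unit_borel"
    using sets_P by (rule measurable_limit_frequency_law)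
  then show "\<exists>\<mu>. de_finetti_mixing_measure P \<mu> \<and>
      (\<exists>\<Theta> \<in> P \<rightarrow>\<^sub>M unit_borel.
        (AE \<omega> in P. (\<lambda>n. sample_mean n \<omega>) \<longlonglongrightarrow> \<Theta> \<omega>) \<and> distr P unit_borel \<Theta> = \<mu>) \<and>
      (\<forall>p\<in>{0..1}. measure P {\<omega> \<in> space P. limit_frequency \<omega> = p} = measure \<mu> {p})"
    using P de_finetti AE_sample_mean_converges measure_limit_frequency_eq
    by (intro exI[of _ ?\<mu>] conjI bexI[of _ limit_frequency] ballI) auto
next
  fix p \<alpha> :: real assume p: "p \<in> {0<..<1}" and \<alpha>: "\<alpha> \<in> {0<..<1}"
  then show "\<exists>P1 P2.
      probability_law P1 \<and> exchangeable P1 \<and> probability_law P2 \<and> exchangeable P2 \<and> P1 \<noteq> P2 \<and>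
      measure P1 {\<omega> \<in> space P1. limit_frequency \<omega> = p} = \<alpha> \<and>
      measure P2 {\<omega> \<in> space P2. limit_frequency \<omega> = p} = \<alpha>"
    by (intro exI[of _ "two_coin_law \<alpha> p 0"] exI[of _ "two_coin_law \<alpha> p 1"] conjI
        probability_law_two_coin_law two_coin_law_atom two_coin_law_neq) auto
qed

end
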